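(* Let $f$ be a probability measure on $\mathbb{R}$ with finite second moment and without an atom at $0$. Then, for any $p\ge 2$, $$\sup_N \int_{\mathbb{R}^N} |x_1|^p \,\hat f^N(dx)<\infty \quad\text{if and only if}\quad \int_{\mathbb{R}}|x|^p f(dx)<\infty.$$
   Context: Kac's sphere is $S^{N-1}=\{x\in\mathbb{R}^N:\sum_i x_i^2=N\}$. For $x\in\mathbb{R}^N\setminus\{0\}$ put $\hat x=\frac{\sqrt N}{|x|}x\in S^{N-1}$. For a probability measure $f$ on $\mathbb{R}$ without an atom at $0$, the rescaled tensor product $\hat f^N$ is the push-forward of $f^{\otimes N}$ under $x\mapsto\hat x$ (a probability measure on $S^{N-1}\subset\mathbb{R}^N$). The supremum is over all $N\in\mathbb{N}$, $N\geq 1$. *)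

theory Defs
  imports "HOL-Probability.Probability"
begin

text \<open>
  Since the dimension \<open>N\<close> varies inside the statement, a point of \<open>\<real>\<^sup>N\<close> is an extensional function
  on the index set \<open>{1..N}\<close>, i.e. an element of \<open>{1..N} \<rightarrow>\<^sub>E UNIV\<close>, and \<open>\<real>\<^sup>N\<close> carries the product
  of the Borel sigma-algebras.
\<close>

abbreviation RN :: "nat \<Rightarrow> (nat \<Rightarrow> real) measure" where
  "RN N \<equiv> \<Pi>\<^sub>M i\<in>{1..N}. borel"

definition kac_sphere :: "nat \<Rightarrow> (nat \<Rightarrow> real) set" where
  "kac_sphere N = {x \<in> {1..N} \<rightarrow>\<^sub>E UNIV. (\<Sum>i\<in>{1..N}. (x i)\<^sup>2) = real N}"

text \<open>
  \<^const>\<open>L2_set\<close> is the Euclidean norm. At the origin, where the map is not meant to be defined,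
  division by zero gives the value \<open>0\<close>; this is a null set for \<open>f\<^sup>\<otimes>\<^sup>N\<close> when \<open>f\<close> has no atom at \<open>0\<close>.
\<close>

definition kac_proj :: "nat \<Rightarrow> (nat \<Rightarrow> real) \<Rightarrow> (nat \<Rightarrow> real)" where
  "kac_proj N x = (\<lambda>i\<in>{1..N}. sqrt (real N) / L2_set x {1..N} * x i)"

definition rescaled_tensor :: "real measure \<Rightarrow> nat \<Rightarrow> (nat \<Rightarrow> real) measure" where
  "rescaled_tensor f N = distr (\<Pi>\<^sub>M i\<in>{1..N}. f) (RN N) (kac_proj N)"

lemma kac_proj_in_kac_sphere:
  assumes "L2_set x {1..N} \<noteq> 0"
  shows "kac_proj N x \<in> kac_sphere N"
proof -
  have "(\<Sum>i\<in>{1..N}. (kac_proj N x i)\<^sup>2) = (\<Sum>i\<in>{1..N}. real N / (L2_set x {1..N})\<^sup>2 * (x i)\<^sup>2)"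
    by (intro sum.cong) (auto simp: kac_proj_def power_mult_distrib power_divide)
  also have "\<dots> = real N / (L2_set x {1..N})\<^sup>2 * (\<Sum>i\<in>{1..N}. (x i)\<^sup>2)"
    by (simp add: sum_distrib_left)
  also have "(\<Sum>i\<in>{1..N}. (x i)\<^sup>2) = (L2_set x {1..N})\<^sup>2"
    by (simp add: L2_set_def sum_nonneg)
  finally show ?thesis
    using assms by (auto simp: kac_sphere_def kac_proj_def)
qed

lemma measurable_kac_proj [measurable]: "kac_proj N \<in> RN N \<rightarrow>\<^sub>M RN N"
  unfolding kac_proj_def L2_set_def by measurable

lemma sets_PiM_real_distribution:
  assumes "real_distribution f"
  shows "sets (\<Pi>\<^sub>M i\<in>{1..N}. f) = sets (RN N)"
proof -
  interpret real_distribution f by fact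
  show ?thesis by (intro sets_PiM_cong) auto
qed

lemma prob_space_rescaled_tensor:
  assumes "real_distribution f"
  shows "prob_space (rescaled_tensor f N)"
proof -
  interpret real_distribution f by fact
  have "prob_space (\<Pi>\<^sub>M i\<in>{1..N}. f)"
    by (intro prob_space_PiM prob_space_axioms)
  moreover have "kac_proj N \<in> (\<Pi>\<^sub>M i\<in>{1..N}. f) \<rightarrow>\<^sub>M RN N"
    by (subst measurable_cong_sets[OF sets_PiM_real_distribution[OF assms] refl])
       (rule measurable_kac_proj)
  ultimately show ?thesis
    unfolding rescaled_tensor_def by (rule prob_space.prob_space_distr)
qed

lemma AE_rescaled_tensor_kac_sphere:
  assumes "real_distribution f" "measure f {0} = 0" "N \<ge> 1"
  shows "AE x in rescaled_tensor f N. x \<in> kac_sphere N"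
proof -
  interpret real_distribution f by fact
  let ?P = "\<Pi>\<^sub>M i\<in>{1..N}. f"
  interpret P: prob_space ?P
    by (intro prob_space_PiM prob_space_axioms)
  have meas: "kac_proj N \<in> ?P \<rightarrow>\<^sub>M RN N"
    by (subst measurable_cong_sets[OF sets_PiM_real_distribution[OF assms(1)] refl])
       (rule measurable_kac_proj)
  have eq: "kac_sphere N = {x \<in> space (RN N). (\<Sum>i\<in>{1..N}. (x i)\<^sup>2) = real N}"
    by (simp add: kac_sphere_def space_PiM)
  have ms: "{x \<in> space (RN N). x \<in> kac_sphere N} \<in> sets (RN N)"
  proof -
    have "{x \<in> space (RN N). (\<Sum>i\<in>{1..N}. (x i)\<^sup>2) = real N} \<in> sets (RN N)"
      by measurable
    then show ?thesis by (simp add: eq)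
  qed
  have "emeasure f {0} = 0"
    using assms(2) by (simp add: emeasure_eq_measure)
  then have "AE x in f. x \<noteq> 0"
    by (intro AE_I[of _ _ "{0}"]) auto
  then have "AE x in ?P. x 1 \<noteq> 0"
    by (intro AE_PiM_component) (use assms(3) prob_space_axioms in auto)
  moreover have "kac_proj N x \<in> kac_sphere N" if "x 1 \<noteq> 0" for x
    using that assms(3) by (intro kac_proj_in_kac_sphere) (force simp: L2_set_eq_0_iff)
  ultimately have "AE x in ?P. kac_proj N x \<in> kac_sphere N"
    by (auto elim: eventually_mono)
  then show ?thesis
    unfolding rescaled_tensor_def by (subst AE_distr_iff[OF meas ms])
qed

end

theory Submission
  imports Defs "HOL-Real_Asymp.Real_Asymp"
begin

text \<open>
  Let \<open>X\<^sub>1, X\<^sub>2, \<dots>\<close> be independent with law \<open>f\<close> and \<open>m = E X\<^sub>1\<^sup>2\<close>. The moments in question are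
  those of \<open>\<bar>X\<^sub>1\<bar> \<surd>(N / S)\<close> with \<open>S = X\<^sub>1\<^sup>2 + \<dots> + X\<^sub>N\<^sup>2\<close>.

  If \<open>E \<bar>X\<^sub>1\<bar>\<^sup>p\<close> is finite, let \<open>\<epsilon> > 0\<close> satisfy \<open>e\<^sup>\<epsilon> E exp (- X\<^sub>1\<^sup>2) < 1\<close>. Where \<open>S \<ge> \<epsilon> N\<close> the integrand is at
  most \<open>\<epsilon> powr (- p / 2) \<bar>X\<^sub>1\<bar>\<^sup>p\<close>; elsewhere it is at most \<open>N powr (p / 2)\<close>, and by Chernoff's bound
  this happens with exponentially small probability.

  Conversely, let \<open>g\<close> be \<open>\<bar>x\<bar>\<^sup>p\<close> truncated to \<open>x\<^sup>2 \<le> m N\<close>. By Markov's inequality the sum of the other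
  squares, which is independent of \<open>X\<^sub>1\<close>, is at most \<open>2 m N\<close> with probability at least \<open>1 / 2\<close>, and then
  \<open>S \<le> 3 m N\<close>. Hence \<open>E g(X\<^sub>1)\<close> is at most \<open>2 (3 m) powr (p / 2)\<close> times the moment, and \<open>N \<rightarrow> \<infinity>\<close>
  removes the truncation.
\<close>

section \<open>Integrals over the product measure and over the rescaled tensor product\<close>

context real_distribution
begin

lemma emeasure_UNIV_1 [simp]: "emeasure M UNIV = 1"
  using emeasure_space_1 by simp

lemma borel_measurable_PiM_component [measurable (raw)]:
  "i \<in> I \<Longrightarrow> (\<lambda>x. x i) \<in> borel_measurable (\<Pi>\<^sub>M i\<in>I. M)"
  using measurable_component_singleton[of i I "\<lambda>_. M"]
  by (simp add: measurable_cong_sets[OF refl events_eq_borel])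

lemma nn_integral_PiM_prod:
  assumes "finite I" "\<And>i. i \<in> I \<Longrightarrow> h i \<in> borel_measurable borel"
  shows "(\<integral>\<^sup>+x. (\<Prod>i\<in>I. h i (x i)) \<partial>(\<Pi>\<^sub>M i\<in>I. M)) = (\<Prod>i\<in>I. \<integral>\<^sup>+x. h i x \<partial>M)"
proof -
  interpret product_prob_space "\<lambda>_. M" by unfold_locales
  show ?thesis
    using assms by (intro product_nn_integral_prod) auto
qed

lemma nn_integral_PiM_component:
  assumes "finite I" "i \<in> I" "g \<in> borel_measurable borel"
  shows "(\<integral>\<^sup>+x. g (x i) \<partial>(\<Pi>\<^sub>M i\<in>I. M)) = (\<integral>\<^sup>+x. g x \<partial>M)"
proof -
  have "(\<integral>\<^sup>+x. (\<Prod>k\<in>I. (if k = i then g else (\<lambda>_. 1)) (x k)) \<partial>(\<Pi>\<^sub>M i\<in>I. M))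
        = (\<Prod>k\<in>I. \<integral>\<^sup>+x. (if k = i then g else (\<lambda>_. 1)) x \<partial>M)"
    using assms by (intro nn_integral_PiM_prod) auto
  then show ?thesis
    using assms by (simp add: prod.remove[of I i])
qed

text \<open>Independence of two coordinates. The integrand is read as a product over all of
  \<open>I\<close> with the constant factor 1 at the remaining indices; these factors integrate to 1
  because \<open>M\<close> is a probability measure.\<close>

lemma nn_integral_PiM_two_components:
  assumes "finite I" "i \<in> I" "j \<in> I" "i \<noteq> j"
    and "g \<in> borel_measurable borel" "h \<in> borel_measurable borel"
  shows "(\<integral>\<^sup>+x. g (x i) * h (x j) \<partial>(\<Pi>\<^sub>M i\<in>I. M)) = (\<integral>\<^sup>+x. g x \<partial>M) * (\<integral>\<^sup>+x. h x \<partial>M)"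
proof -
  let ?u = "\<lambda>k. if k = i then g else if k = j then h else (\<lambda>_. 1)"
  have split: "(\<Prod>k\<in>I. F k) = F i * (F j * (\<Prod>k\<in>I-{i}-{j}. F k))" for F :: "'a \<Rightarrow> ennreal"
    using assms by (simp add: prod.remove[of I i] prod.remove[of "I-{i}" j])
  have "(\<integral>\<^sup>+x. (\<Prod>k\<in>I. ?u k (x k)) \<partial>(\<Pi>\<^sub>M i\<in>I. M)) = (\<Prod>k\<in>I. \<integral>\<^sup>+x. ?u k x \<partial>M)"
    using assms by (intro nn_integral_PiM_prod) auto
  moreover have "(\<Prod>k\<in>I-{i}-{j}. \<integral>\<^sup>+x. ?u k x \<partial>M) = 1"
    by (intro prod.neutral) auto
  moreover have "(\<Prod>k\<in>I-{i}-{j}. ?u k (x k)) = 1" for x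
    by (intro prod.neutral) auto
  ultimately show ?thesis
    using assms(4) unfolding split by simp
qed

lemma nn_integral_rescaled_tensor:
  assumes "N \<ge> 1" "g \<in> borel_measurable borel"
  shows "(\<integral>\<^sup>+x. g (x 1) \<partial>rescaled_tensor M N)
    = (\<integral>\<^sup>+x. g (sqrt (real N) / L2_set x {1..N} * x 1) \<partial>(\<Pi>\<^sub>M i\<in>{1..N}. M))"
proof -
  have [measurable]: "kac_proj N \<in> (\<Pi>\<^sub>M i\<in>{1..N}. M) \<rightarrow>\<^sub>M RN N"
    by (subst measurable_cong_sets[OF sets_PiM_real_distribution[OF real_distribution_axioms] refl])
       (rule measurable_kac_proj)
  have [measurable]: "(\<lambda>x. x 1) \<in> borel_measurable (RN N)"
    using assms(1) by (intro measurable_component_singleton) auto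
  have [measurable]: "(\<lambda>x. g (x 1)) \<in> borel_measurable (RN N)"
    using assms(2) by measurable
  show ?thesis
    unfolding rescaled_tensor_def
    by (subst nn_integral_distr, measurable) (use assms(1) in \<open>simp add: kac_proj_def\<close>)
qed

end

section \<open>Pointwise bounds on a rescaled coordinate\<close>

lemma abs_kac_coordinate_powr:
  fixes s t p :: real
  assumes "s \<ge> 0"
  shows "\<bar>sqrt (real N) / sqrt s * t\<bar> powr p = (real N / s) powr (p / 2) * \<bar>t\<bar> powr p"
proof -
  \<comment> \<open>This includes \<open>s = 0\<close>, where both sides are 0 because division by
    zero gives 0.\<close>
  have "sqrt (real N) / sqrt s = sqrt (real N / s)"
    by (simp add: real_sqrt_divide)
  moreover have "sqrt y powr p = y powr (p / 2)" if "y \<ge> 0" for y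
    using that by (simp add: powr_half_sqrt[symmetric] powr_powr)
  ultimately show ?thesis
    using assms by (simp add: abs_mult powr_mult)
qed

text \<open>Here \<open>t\<close> is one coordinate and \<open>s\<close> the sum of all squares. The
  bounds for large and small \<open>s\<close> are added, so that they can be integrated term by
  term. The factor \<open>exp (e * real N - s)\<close> dominates the indicator of
  \<open>s < e * real N\<close>, and \<open>exp (- s)\<close> factorises over the
  coordinates.\<close>

lemma kac_upper_pointwise:
  fixes s t p e :: real
  assumes "p > 0" "e > 0" "N \<ge> 1" "t\<^sup>2 \<le> s"
  shows "\<bar>sqrt (real N) / sqrt s * t\<bar> powr p
    \<le> (1 / e) powr (p / 2) * \<bar>t\<bar> powr p + real N powr (p / 2) * exp (e * real N) * exp (- s)"
proof (cases "s \<ge> e * real N")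
  case True
  with assms have "s > 0"
    by (smt (verit, best) mult_pos_pos of_nat_0_less_iff less_le_trans zero_less_one)
  have "(real N / s) powr (p / 2) \<le> (1 / e) powr (p / 2)"
    using assms True \<open>s > 0\<close> by (intro powr_mono2) (auto simp: field_simps)
  then have "(real N / s) powr (p / 2) * \<bar>t\<bar> powr p \<le> (1 / e) powr (p / 2) * \<bar>t\<bar> powr p"
    by (intro mult_right_mono) auto
  moreover have "0 \<le> real N powr (p / 2) * exp (e * real N) * exp (- s)"
    by simp
  ultimately show ?thesis
    using abs_kac_coordinate_powr[of s N t p] \<open>s > 0\<close> assms by linarith
next
  case False
  have "0 \<le> s" using assms(4) by (smt (verit) zero_le_power2)
  have "\<bar>t\<bar> \<le> sqrt s"
    using assms(4) by (metis real_sqrt_abs real_sqrt_le_mono)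
  then have "\<bar>sqrt (real N) / sqrt s * t\<bar> \<le> sqrt (real N)"
    using \<open>0 \<le> s\<close> by (cases "s = 0") (auto simp: abs_mult field_simps intro!: mult_right_mono)
  then have "\<bar>sqrt (real N) / sqrt s * t\<bar> powr p \<le> sqrt (real N) powr p"
    using assms by (intro powr_mono2) auto
  also have "\<dots> = real N powr (p / 2)"
    by (simp add: powr_half_sqrt[symmetric] powr_powr)
  \<comment> \<open>In this case \<open>s < e * real N\<close>, so the exponential is at least
    1.\<close>
  also have "\<dots> \<le> real N powr (p / 2) * exp (e * real N - s)"
    using False by (simp add: mult_le_cancel_left1)
  also have "\<dots> = real N powr (p / 2) * exp (e * real N) * exp (- s)"
    by (simp add: mult.assoc mult_exp_exp)
  also have "\<dots> \<le> (1 / e) powr (p / 2) * \<bar>t\<bar> powr p + \<dots>"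
    by simp
  finally show ?thesis by simp
qed

text \<open>Here \<open>r\<close> is the sum of the squares of the other coordinates. The last
  summand is Markov's inequality in pointwise form: it is at least \<open>g\<close> once
  \<open>r\<close> reaches \<open>2 * m * real N\<close>. Being linear in \<open>r\<close>, it can
  be integrated by independence.\<close>

lemma kac_lower_pointwise:
  fixes r t p m :: real
  assumes "p > 0" "m > 0" "N \<ge> 1" "r \<ge> 0"
  defines "g \<equiv> \<bar>t\<bar> powr p * indicator {t. t\<^sup>2 \<le> m * real N} t"
  shows "g \<le> (3 * m) powr (p / 2) * \<bar>sqrt (real N) / sqrt (t\<^sup>2 + r) * t\<bar> powr p
    + g * (r / (2 * m * real N))"
proof -
  have g: "g \<ge> 0" by (simp add: g_def)
  have mN: "m * real N > 0" using assms by simp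
  \<comment> \<open>The truncation or \<open>0 powr p = 0\<close> makes \<open>g\<close> vanish in
    the first case, and Markov's term alone suffices in the second. In the third, the total sum of
    squares is positive and at most \<open>3 * m * real N\<close>, which is the source of the factor
    3.\<close>
  consider "t = 0 \<or> t\<^sup>2 > m * real N" | "r \<ge> 2 * m * real N"
    | "t \<noteq> 0" "t\<^sup>2 \<le> m * real N" "r \<le> 2 * m * real N"
    by linarith
  then show ?thesis
  proof cases
    case 1
    then have "g = 0" by (auto simp: g_def)
    then show ?thesis by simp
  next
    case 2
    then have "g * 1 \<le> g * (r / (2 * m * real N))"
      using g mN by (intro mult_left_mono) (auto simp: field_simps)
    moreover have "0 \<le> (3 * m) powr (p / 2) * \<bar>sqrt (real N) / sqrt (t\<^sup>2 + r) * t\<bar> powr p"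
      by simp
    ultimately show ?thesis by linarith
  next
    case 3
    have pos: "t\<^sup>2 + r > 0" using 3 assms by (simp add: add_pos_nonneg)
    have "1 \<le> 3 * m * (real N / (t\<^sup>2 + r))"
      using 3 pos by (simp add: field_simps)
    then have "1 \<le> (3 * m * (real N / (t\<^sup>2 + r))) powr (p / 2)"
      using assms by (intro ge_one_powr_ge_zero) auto
    then have "1 * \<bar>t\<bar> powr p \<le> (3 * m * (real N / (t\<^sup>2 + r))) powr (p / 2) * \<bar>t\<bar> powr p"
      by (intro mult_right_mono) auto
    also have "(3 * m * (real N / (t\<^sup>2 + r))) powr (p / 2)
        = (3 * m) powr (p / 2) * (real N / (t\<^sup>2 + r)) powr (p / 2)"
      using pos assms(2) by (intro powr_mult)
    also have "\<dots> * \<bar>t\<bar> powr p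
        = (3 * m) powr (p / 2) * \<bar>sqrt (real N) / sqrt (t\<^sup>2 + r) * t\<bar> powr p"
      using abs_kac_coordinate_powr[of "t\<^sup>2 + r" N t p] pos assms(3) by simp
    finally have "g \<le> (3 * m) powr (p / 2) * \<bar>sqrt (real N) / sqrt (t\<^sup>2 + r) * t\<bar> powr p"
      using 3 by (simp add: g_def)
    moreover have "0 \<le> g * (r / (2 * m * real N))"
      using g mN assms by simp
    ultimately show ?thesis by linarith
  qed
qed

section \<open>Consequences of the absence of an atom at 0, and the moment estimates\<close>

context real_distribution
begin

lemma AE_nonzero:
  assumes "measure M {0} = 0"
  shows "AE x in M. x \<noteq> 0"
  using assms by (intro AE_I[of _ _ "{0}"]) (auto simp: emeasure_eq_measure)

text \<open>The integrand is below 1 except at 0, so equality would force all mass onto 0. This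
  strict inequality makes Chernoff's bound decay exponentially.\<close>

lemma nn_integral_exp_neg_square_less_1:
  assumes "measure M {0} = 0"
  shows "(\<integral>\<^sup>+x. ennreal (exp (- x\<^sup>2)) \<partial>M) < 1"
proof -
  have "(\<integral>\<^sup>+x. ennreal (exp (- x\<^sup>2)) \<partial>M) < (\<integral>\<^sup>+x. 1 \<partial>M)"
  proof (rule nn_integral_less)
    have "(\<integral>\<^sup>+x. ennreal (exp (- x\<^sup>2)) \<partial>M) \<le> (\<integral>\<^sup>+x. 1 \<partial>M)"
      by (intro nn_integral_mono) auto
    also have "\<dots> < \<infinity>" by simp
    finally show "(\<integral>\<^sup>+x. ennreal (exp (- x\<^sup>2)) \<partial>M) \<noteq> \<infinity>" by simp
    show "\<not> (AE x in M. 1 \<le> ennreal (exp (- x\<^sup>2)))"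
    proof
      assume "AE x in M. 1 \<le> ennreal (exp (- x\<^sup>2))"
      with AE_nonzero[OF assms] have "AE x in M. False"
        by eventually_elim (auto simp: ennreal_1[symmetric] simp del: ennreal_1)
      then show False by simp
    qed
  qed auto
  then show ?thesis by simp
qed

lemma nn_integral_square_pos:
  assumes "measure M {0} = 0"
  shows "0 < (\<integral>\<^sup>+x. ennreal (x\<^sup>2) \<partial>M)"
proof (rule ccontr)
  assume "\<not> ?thesis"
  then have "AE x in M. ennreal (x\<^sup>2) = 0"
    by (subst (asm) zero_less_iff_neq_zero) (simp add: nn_integral_0_iff_AE)
  with AE_nonzero[OF assms] have "AE x in M. False"
    by eventually_elim simp
  then show False by simp
qed

text \<open>The integrated form of \<open>kac_upper_pointwise\<close>. The point is that
  \<open>A\<close> and \<open>B\<close> do not depend on \<open>N\<close>.\<close>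

lemma rescaled_moment_upper:
  assumes "measure M {0} = 0" "p > 0"
  obtains A B where "A \<ge> 0" "B \<ge> 0"
    "\<And>N. N \<ge> 1 \<Longrightarrow> (\<integral>\<^sup>+ x. ennreal (\<bar>x 1\<bar> powr p) \<partial>rescaled_tensor M N)
      \<le> ennreal A * (\<integral>\<^sup>+ x. ennreal (\<bar>x\<bar> powr p) \<partial>M) + ennreal B"
proof -
  define q where "q = (\<integral>\<^sup>+x. ennreal (exp (- x\<^sup>2)) \<partial>M)"
  \<comment> \<open>A real number strictly between \<open>q\<close> and 1 is taken, so that
    \<open>c > 0\<close> and \<open>ln c\<close> is meaningful.\<close>
  obtain c where c: "0 < c" "c < 1" "q \<le> ennreal c"
  proof -
    have "q < 1" using nn_integral_exp_neg_square_less_1[OF assms(1)] by (simp add: q_def)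
    then obtain c' where c': "q < c'" "c' < 1" using dense by blast
    then obtain c where "c' = ennreal c" "0 \<le> c" by (cases c') auto
    with c' that[of c] show ?thesis
      by (cases "c = 0") (auto simp: ennreal_1[symmetric] ennreal_less_iff simp del: ennreal_1)
  qed
  \<comment> \<open>Half of the available rate: \<open>exp e * c\<close> is then the square root of
    \<open>c\<close>, still below 1, and the loss \<open>exp (e * real N)\<close> is
    absorbed.\<close>
  define e where "e = - ln c / 2"
  have e: "e > 0" using c by (simp add: e_def)
  have ec: "exp e * c = exp (- e)"
  proof -
    have "c = exp (- 2 * e)" using c by (simp add: e_def)
    then show ?thesis by (simp add: exp_add[symmetric])
  qed
  \<comment> \<open>Exponential decay beats the power of \<open>N\<close>; a convergent sequence is
    bounded, which gives \<open>B\<close>.\<close>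
  have "(\<lambda>N. real N powr (p / 2) * exp (- e * real N)) \<longlonglongrightarrow> 0"
    using e by real_asymp
  then have "Bseq (\<lambda>N. real N powr (p / 2) * exp (- e * real N))"
    by (intro convergent_imp_Bseq) (auto simp: convergent_def)
  then obtain B where B: "B > 0" "\<And>N. real N powr (p / 2) * exp (- e * real N) \<le> B"
    by (auto elim!: BseqE simp: abs_mult)
  define A where "A = (1 / e) powr (p / 2)"
  show ?thesis
  proof (rule that[of A B])
    fix N :: nat assume N: "N \<ge> 1"
    let ?P = "\<Pi>\<^sub>M i\<in>{1..N}. M"
    define D where "D = real N powr (p / 2) * exp (e * real N)"
    have "(\<integral>\<^sup>+ x. ennreal (\<bar>x 1\<bar> powr p) \<partial>rescaled_tensor M N)
      = (\<integral>\<^sup>+ x. ennreal (\<bar>sqrt (real N) / L2_set x {1..N} * x 1\<bar> powr p) \<partial>?P)"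
      using N by (intro nn_integral_rescaled_tensor) auto
    also have "\<dots> \<le> (\<integral>\<^sup>+ x. ennreal A * ennreal (\<bar>x 1\<bar> powr p)
        + ennreal D * (\<Prod>i\<in>{1..N}. ennreal (exp (- (x i)\<^sup>2))) \<partial>?P)"
    proof (intro nn_integral_mono)
      fix x :: "nat \<Rightarrow> real"
      have "(x 1)\<^sup>2 \<le> (\<Sum>i\<in>{1..N}. (x i)\<^sup>2)"
        using N by (intro member_le_sum) auto
      then have "\<bar>sqrt (real N) / L2_set x {1..N} * x 1\<bar> powr p
          \<le> A * \<bar>x 1\<bar> powr p + D * exp (- (\<Sum>i\<in>{1..N}. (x i)\<^sup>2))"
        unfolding L2_set_def A_def D_def using assms e N by (intro kac_upper_pointwise)
      also have "exp (- (\<Sum>i\<in>{1..N}. (x i)\<^sup>2)) = (\<Prod>i\<in>{1..N}. exp (- (x i)\<^sup>2))"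
        by (simp add: exp_sum sum_negf[symmetric])
      finally show "ennreal (\<bar>sqrt (real N) / L2_set x {1..N} * x 1\<bar> powr p)
          \<le> ennreal A * ennreal (\<bar>x 1\<bar> powr p)
            + ennreal D * (\<Prod>i\<in>{1..N}. ennreal (exp (- (x i)\<^sup>2)))"
        by (simp add: ennreal_mult'[symmetric] ennreal_plus[symmetric] prod_ennreal A_def D_def
            prod_nonneg ennreal_leI del: ennreal_plus)
    qed
    also have "\<dots> = ennreal A * (\<integral>\<^sup>+ x. ennreal (\<bar>x 1\<bar> powr p) \<partial>?P)
        + ennreal D * (\<integral>\<^sup>+ x. (\<Prod>i\<in>{1..N}. ennreal (exp (- (x i)\<^sup>2))) \<partial>?P)"
      using N by (simp add: nn_integral_add nn_integral_cmult)
    \<comment> \<open>The factors are independent, each with mean \<open>q\<close>.\<close>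
    also have "(\<integral>\<^sup>+ x. (\<Prod>i\<in>{1..N}. ennreal (exp (- (x i)\<^sup>2))) \<partial>?P) = q ^ N"
      by (subst nn_integral_PiM_prod[where h = "\<lambda>_ y. ennreal (exp (- y\<^sup>2))"]) (auto simp: q_def)
    also have "(\<integral>\<^sup>+ x. ennreal (\<bar>x 1\<bar> powr p) \<partial>?P) = (\<integral>\<^sup>+ x. ennreal (\<bar>x\<bar> powr p) \<partial>M)"
      using N by (intro nn_integral_PiM_component) auto
    also have "ennreal D * q ^ N \<le> ennreal D * ennreal c ^ N"
      using c by (intro mult_left_mono power_mono) auto
    also have "\<dots> = ennreal (D * c ^ N)"
      using c by (simp add: ennreal_power ennreal_mult' D_def)
    also have "D * c ^ N = real N powr (p / 2) * (exp e * c) ^ N"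
      by (simp add: D_def power_mult_distrib exp_of_nat_mult[symmetric] mult.commute)
    also have "\<dots> = real N powr (p / 2) * exp (- e * real N)"
      unfolding ec by (simp add: exp_of_nat_mult[symmetric] mult.commute)
    also have "ennreal \<dots> \<le> ennreal B"
      using B by (intro ennreal_leI)
    finally show "(\<integral>\<^sup>+ x. ennreal (\<bar>x 1\<bar> powr p) \<partial>rescaled_tensor M N)
      \<le> ennreal A * (\<integral>\<^sup>+ x. ennreal (\<bar>x\<bar> powr p) \<partial>M) + ennreal B"
      by (simp add: add_left_mono)
  qed (use B in \<open>auto simp: A_def\<close>)
qed

text \<open>Integrating \<open>kac_lower_pointwise\<close> bounds the truncated moment
  \<open>G\<close> by \<open>A * I\<close> plus Markov's term, which is at most
  \<open>G / 2\<close>. Moving that half to the left gives the factor 2.\<close>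

lemma truncated_moment_le_rescaled_moment:
  assumes m: "(\<integral>\<^sup>+x. ennreal (x\<^sup>2) \<partial>M) = ennreal m" "m > 0" and "p > 0" "N \<ge> 1"
  shows "(\<integral>\<^sup>+x. ennreal (\<bar>x\<bar> powr p * indicator {t. t\<^sup>2 \<le> m * real N} x) \<partial>M)
    \<le> 2 * ennreal ((3 * m) powr (p / 2)) * (\<integral>\<^sup>+ x. ennreal (\<bar>x 1\<bar> powr p) \<partial>rescaled_tensor M N)"
proof -
  let ?P = "\<Pi>\<^sub>M i\<in>{1..N}. M"
  define g where "g = (\<lambda>x. \<bar>x\<bar> powr p * indicator {t. t\<^sup>2 \<le> m * real N} (x::real))"
  define A where "A = (3 * m) powr (p / 2)"
  define I where "I = (\<integral>\<^sup>+ x. ennreal (\<bar>x 1\<bar> powr p) \<partial>rescaled_tensor M N)"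
  define G where "G = (\<integral>\<^sup>+x. ennreal (g x) \<partial>M)"
  define d where "d = 1 / (2 * m * real N)"
  have d: "d \<ge> 0" using assms by (simp add: d_def)
  have g [measurable]: "g \<in> borel_measurable borel" and g0: "\<And>x. g x \<ge> 0"
    by (auto simp: g_def)
  have split: "{1..N} = insert 1 {2..N}" using assms(4) by auto
  define F where "F = (\<lambda>x. ennreal (\<bar>sqrt (real N) / L2_set x {1..N} * x 1\<bar> powr p))"
  define H where "H = (\<lambda>(i::nat) x. ennreal (g (x 1)) * ennreal ((x i)\<^sup>2))"
  have [measurable]: "(\<lambda>x. x 1) \<in> borel_measurable ?P"
    using assms(4) by (intro borel_measurable_PiM_component) auto
  have F: "F \<in> borel_measurable ?P"
    unfolding F_def L2_set_def by measurable
  have H: "H i \<in> borel_measurable ?P" if "i \<in> {2..N}" for i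
  proof -
    have [measurable]: "(\<lambda>x. x i) \<in> borel_measurable ?P"
      using that by (intro borel_measurable_PiM_component) auto
    show ?thesis unfolding H_def by measurable
  qed
  have intF: "(\<integral>\<^sup>+x. F x \<partial>?P) = I"
    unfolding I_def F_def using assms(4)
    by (intro nn_integral_rescaled_tensor[where g = "\<lambda>y. ennreal (\<bar>y\<bar> powr p)", symmetric]) auto
  have intH: "(\<integral>\<^sup>+x. H i x \<partial>?P) = G * ennreal m" if "i \<in> {2..N}" for i
    unfolding G_def H_def m(1)[symmetric] using assms(4) that
    by (intro nn_integral_PiM_two_components[where g = "\<lambda>x. ennreal (g x)" and h = "\<lambda>x. ennreal (x\<^sup>2)"])
       auto
  \<comment> \<open>Markov's term is split into the summands \<open>H i\<close>, each a product of
    functions of two distinct coordinates, so that its integral is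
    \<open>G * ennreal m\<close>.\<close>
  have pointwise: "ennreal (g (x 1)) \<le> ennreal A * F x + ennreal d * (\<Sum>i\<in>{2..N}. H i x)" for x
  proof -
    define r where "r = (\<Sum>i\<in>{2..N}. (x i)\<^sup>2)"
    have r: "r \<ge> 0" by (simp add: r_def sum_nonneg)
    have L: "sqrt (\<Sum>i\<in>{1..N}. (x i)\<^sup>2) = sqrt ((x 1)\<^sup>2 + r)"
      unfolding r_def split by simp
    have "g (x 1) \<le> A * \<bar>sqrt (real N) / sqrt ((x 1)\<^sup>2 + r) * x 1\<bar> powr p
        + g (x 1) * (r / (2 * m * real N))"
      unfolding g_def A_def using assms r by (intro kac_lower_pointwise)
    then have "g (x 1) \<le> A * \<bar>sqrt (real N) / L2_set x {1..N} * x 1\<bar> powr p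
        + d * (\<Sum>i\<in>{2..N}. g (x 1) * (x i)\<^sup>2)"
      unfolding L2_set_def L d_def by (simp add: r_def sum_distrib_left[symmetric])
    then show ?thesis
      unfolding F_def H_def using d g0
      by (simp add: ennreal_mult[symmetric] ennreal_plus[symmetric] A_def sum_nonneg
            sum_ennreal ennreal_leI del: ennreal_plus)
  qed
  have "G = (\<integral>\<^sup>+x. ennreal (g (x 1)) \<partial>?P)"
    unfolding G_def using assms(4)
    by (intro nn_integral_PiM_component[where g = "\<lambda>x. ennreal (g x)", symmetric]) auto
  also have "\<dots> \<le> (\<integral>\<^sup>+x. ennreal A * F x + ennreal d * (\<Sum>i\<in>{2..N}. H i x) \<partial>?P)"
    by (intro nn_integral_mono pointwise)
  also have "\<dots> = ennreal A * (\<integral>\<^sup>+x. F x \<partial>?P) + ennreal d * (\<Sum>i\<in>{2..N}. \<integral>\<^sup>+x. H i x \<partial>?P)"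
  proof -
    have "(\<lambda>x. \<Sum>i\<in>{2..N}. H i x) \<in> borel_measurable ?P"
      using H by (intro borel_measurable_sum)
    moreover have "(\<integral>\<^sup>+x. (\<Sum>i\<in>{2..N}. H i x) \<partial>?P) = (\<Sum>i\<in>{2..N}. \<integral>\<^sup>+x. H i x \<partial>?P)"
      using H by (intro nn_integral_sum)
    ultimately show ?thesis
      using F by (simp add: nn_integral_add nn_integral_cmult)
  qed
  also have "\<dots> = ennreal A * I + ennreal d * (\<Sum>i\<in>{2..N}. G * ennreal m)"
    using intF intH by simp
  finally have main: "G \<le> ennreal A * I + ennreal d * (\<Sum>i\<in>{2..N}. G * ennreal m)" .
  \<comment> \<open>The truncation bounds \<open>g\<close>, so \<open>G\<close> is finite and half
    of it may be subtracted below.\<close>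
  have "G \<le> (\<integral>\<^sup>+x. ennreal ((m * real N) powr (p / 2)) \<partial>M)"
    unfolding G_def
  proof (intro nn_integral_mono ennreal_leI)
    fix x
    have "\<bar>x\<bar> powr p = (x\<^sup>2) powr (p / 2)"
      using powr_powr[of "x\<^sup>2" "1 / 2" p] by (simp add: powr_half_sqrt)
    then show "g x \<le> (m * real N) powr (p / 2)"
      using assms by (auto simp: g_def indicator_def intro!: powr_mono2)
  qed
  also have "\<dots> < \<infinity>" by simp
  finally obtain \<gamma> where \<gamma>: "G = ennreal \<gamma>" "\<gamma> \<ge> 0" by (cases G) auto
  show ?thesis
  proof (cases I)
    case (real \<iota>)
    have "ennreal \<gamma> \<le> ennreal (A * \<iota> + d * (real (N - 1) * (\<gamma> * m)))"
      using main \<gamma> real d m(2)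
      by (simp add: ennreal_mult[symmetric] ennreal_plus[symmetric] ennreal_of_nat_eq_real_of_nat
          A_def del: ennreal_plus)
    then have "\<gamma> \<le> A * \<iota> + d * (real (N - 1) * (\<gamma> * m))"
      using real \<gamma> d m(2) by (subst (asm) ennreal_le_iff) (auto simp: A_def)
    \<comment> \<open>Counting \<open>N\<close> instead of the actual \<open>N - 1\<close> other
      coordinates turns Markov's term into exactly half of \<open>\<gamma>\<close>.\<close>
    also have "\<dots> \<le> A * \<iota> + d * (real N * (\<gamma> * m))"
      using \<gamma> d m(2) by (intro add_left_mono mult_left_mono mult_right_mono) auto
    also have "d * (real N * (\<gamma> * m)) = \<gamma> / 2"
      using m(2) assms(4) by (simp add: d_def)
    finally have "\<gamma> \<le> 2 * A * \<iota>" by simp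
    then have "G \<le> ennreal (2 * A * \<iota>)"
      unfolding \<gamma> by (rule ennreal_leI)
    also have "\<dots> = 2 * ennreal A * I"
      using real by (simp add: ennreal_mult A_def)
    finally show ?thesis
      by (simp add: G_def g_def A_def I_def)
  next
    \<comment> \<open>The right-hand side is infinite, since its constant factor is
      positive.\<close>
    case top
    moreover have "2 * ennreal A \<noteq> 0"
      using m(2) by (simp add: A_def)
    ultimately have "G \<le> 2 * ennreal A * I"
      by (simp add: ennreal_mult_top)
    then show ?thesis
      by (simp add: G_def g_def A_def I_def)
  qed
qed

text \<open>As \<open>m > 0\<close>, the truncation sets increase to the whole line, and monotone
  convergence applies.\<close>

lemma moment_le_SUP_truncated_moment:
  assumes "m > 0"
  shows "(\<integral>\<^sup>+x. ennreal (\<bar>x\<bar> powr p) \<partial>M)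
    \<le> (SUP N\<in>{1::nat..}. \<integral>\<^sup>+x. ennreal (\<bar>x\<bar> powr p * indicator {t. t\<^sup>2 \<le> m * real N} x) \<partial>M)"
proof -
  let ?g = "\<lambda>N x. ennreal (\<bar>x\<bar> powr p * indicator {t. t\<^sup>2 \<le> m * real N} x)"
  \<comment> \<open>The index is shifted by \<open>Suc\<close> because the supremum starts at 1,
    while monotone convergence runs over all naturals.\<close>
  have "ennreal (\<bar>x\<bar> powr p) \<le> (SUP N. ?g (Suc N) x)" for x
  proof -
    obtain N where "x\<^sup>2 / m < real N" using reals_Archimedean2 by blast
    then have "x\<^sup>2 < m * real N"
      using assms by (simp add: field_simps)
    also have "\<dots> \<le> m * real (Suc N)" using assms by simp
    finally have "ennreal (\<bar>x\<bar> powr p) \<le> ?g (Suc N) x" by simp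
    then show ?thesis by (rule SUP_upper2[OF UNIV_I])
  qed
  then have "(\<integral>\<^sup>+x. ennreal (\<bar>x\<bar> powr p) \<partial>M) \<le> (\<integral>\<^sup>+x. (SUP N. ?g (Suc N) x) \<partial>M)"
    by (intro nn_integral_mono)
  also have "\<dots> = (SUP N. \<integral>\<^sup>+x. ?g (Suc N) x \<partial>M)"
  proof (rule nn_integral_monotone_convergence_SUP)
    show "incseq (\<lambda>N. ?g (Suc N))"
    proof (intro incseq_SucI le_funI ennreal_leI mult_left_mono)
      fix N x
      have "m * real (Suc N) \<le> m * real (Suc (Suc N))" using assms by simp
      then show "indicat_real {t. t\<^sup>2 \<le> m * real (Suc N)} x
          \<le> indicat_real {t. t\<^sup>2 \<le> m * real (Suc (Suc N))} x"
        by (auto simp: indicator_def simp del: of_nat_Suc)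
    qed auto
  qed auto
  also have "\<dots> \<le> (SUP N\<in>{1..}. \<integral>\<^sup>+x. ?g N x \<partial>M)"
    by (intro SUP_least SUP_upper) auto
  finally show ?thesis .
qed

end

theorem lemma6:
  fixes f :: "real measure" and p :: real
  assumes "real_distribution f"
    and "(\<integral>\<^sup>+ x. ennreal (x\<^sup>2) \<partial>f) < \<infinity>"
    and "measure f {0} = 0"
    and "p \<ge> 2"
  shows "(SUP N\<in>{1..}. \<integral>\<^sup>+ x. ennreal (\<bar>x 1\<bar> powr p) \<partial>(rescaled_tensor f N)) < \<infinity>
     \<longleftrightarrow> (\<integral>\<^sup>+ x. ennreal (\<bar>x\<bar> powr p) \<partial>f) < \<infinity>"
    (is "?S < \<infinity> \<longleftrightarrow> ?E < \<infinity>")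
proof
  interpret real_distribution f by fact
  have p: "p > 0" using assms(4) by simp
  show "?E < \<infinity>" if "?S < \<infinity>"
  proof -
    \<comment> \<open>The second moment is finite by assumption, and positive because there is no
      atom at 0.\<close>
    obtain m where m: "(\<integral>\<^sup>+ x. ennreal (x\<^sup>2) \<partial>f) = ennreal m" "m > 0"
      using assms(2) nn_integral_square_pos[OF assms(3)]
      by (cases "\<integral>\<^sup>+ x. ennreal (x\<^sup>2) \<partial>f") auto
    let ?A = "2 * ennreal ((3 * m) powr (p / 2))"
    have "?E \<le> (SUP N\<in>{1::nat..}. \<integral>\<^sup>+x. ennreal (\<bar>x\<bar> powr p * indicator {t. t\<^sup>2 \<le> m * real N} x) \<partial>f)"
      using m(2) by (rule moment_le_SUP_truncated_moment)
    also have "\<dots> \<le> ?A * ?S"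
    proof (rule SUP_least)
      fix N :: nat assume N: "N \<in> {1..}"
      have "(\<integral>\<^sup>+x. ennreal (\<bar>x\<bar> powr p * indicator {t. t\<^sup>2 \<le> m * real N} x) \<partial>f)
          \<le> ?A * (\<integral>\<^sup>+ x. ennreal (\<bar>x 1\<bar> powr p) \<partial>rescaled_tensor f N)"
        using N by (intro truncated_moment_le_rescaled_moment m p) auto
      also have "\<dots> \<le> ?A * ?S"
        using N by (intro mult_left_mono SUP_upper) auto
      finally show "(\<integral>\<^sup>+x. ennreal (\<bar>x\<bar> powr p * indicator {t. t\<^sup>2 \<le> m * real N} x) \<partial>f) \<le> ?A * ?S" .
    qed
    also have "\<dots> < \<infinity>"
      using that by (simp add: ennreal_mult_less_top)
    finally show ?thesis .
  qed
  show "?S < \<infinity>" if "?E < \<infinity>"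
  proof -
    obtain A B where AB: "A \<ge> 0" "B \<ge> 0" "\<And>N. N \<ge> 1 \<Longrightarrow>
        (\<integral>\<^sup>+ x. ennreal (\<bar>x 1\<bar> powr p) \<partial>rescaled_tensor f N) \<le> ennreal A * ?E + ennreal B"
      using rescaled_moment_upper[OF assms(3) p] by blast
    then have "?S \<le> ennreal A * ?E + ennreal B"
      by (intro SUP_least) auto
    also have "\<dots> < \<infinity>"
      using that by (simp add: ennreal_mult_less_top)
    finally show ?thesis .
  qed
qed

end
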